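(* Let $\mathcal{K}\subset\widehat{\mathbb{C}}=\mathbb{C}\cup\{\infty\}$ be a domain with $\infty\in\mathcal{K}$ whose boundary $\Gamma$ consists of $\ell$ pairwise disjoint closed Jordan curves $\Gamma_1,\ldots,\Gamma_\ell$ with the smooth parametrization $\eta$ on $J$ described in the context. Let $\Phi:\mathcal{K}\to\mathcal{L}$ be the conformal map onto the lemniscatic domain with parameters $a_1,\ldots,a_\ell$, $m_1,\ldots,m_\ell$, $\tau$ given by Walsh's theorem. Fix a point $\alpha_j$ in the interior of $\Gamma_j$ for each $j=1,\ldots,\ell$. Let $$f(z)=\sum_{j=1}^\ell m_j\log\left(\frac{\Phi(z)-a_j}{z-\alpha_j}\right),\qquad z\in\mathcal{K},$$ which is analytic in $\mathcal{K}$ with $f(\infty)=0$ and has boundary values $$f(\eta(t))=\log\tau+\gamma(t)+\mathrm{i}\mu(t),\quad t\in J,\qquad \gamma(t)=-\sum_{j=1}^\ell m_j\log|\eta(t)-\alpha_j|,\qquad \mu(t)=\operatorname{Im} f(\eta(t)).$$ For $j=1,\ldots,\ell$ let $\gamma_j(t)=-\log|\eta(t)-\alpha_j|$, and let $\mu_j$, $h_j$, $f_j$ be the real-valued function on $J$, the piecewise constant real-valued function on $J$, and the analytic function on $\mathcal{K}$ associated with $\gamma_j$ as in the context. Then for all $t\in J$ $$\mu(t)=\sum_{j=1}^\ell m_j\mu_j(t),\qquad \log\tau=\sum_{j=1}^\ell m_jh_j(t),$$ and $f(z)=\sum_{j=1}^\ell m_jf_j(z)$ for all $z\in\mathcal{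K}$.
   Context: Boundary parametrization. $\Gamma$ is oriented so that $\mathcal{K}$ lies to the left of $\Gamma$. Each $\Gamma_j$ is parametrized by a $2\pi$-periodic, twice continuously differentiable complex function $\eta_j(t)$, $t\in J_j=[0,2\pi]$, with $\dot\eta_j(t)\neq0$. $J$ is the disjoint union of $J_1,\ldots,J_\ell$, and $\eta$ on $J$ is defined by $\eta(t)=\eta_j(t)$ for $t\in J_j$. Functions on $\Gamma$ are identified with functions on $J$ via $\eta$. A piecewise constant function $h$ on $J$ is one that is constant on each $J_k$, written $h=(h_1,\ldots,h_\ell)$ with $h(t)=h_k$ for $t\in J_k$. Walsh's theorem (known). For $\mathcal{K}$ as in the claim there exist a unique lemniscatic domain $$\mathcal{L}=\Big\{w\in\widehat{\mathbb{C}}:\prod_{j=1}^\ell|w-a_j|^{m_j}>\tau\Big\},$$ with $a_1,\ldots,a_\ell\in\mathbb{C}$ pairwise distinct, $m_1,\ldots,m_\ell,\tau>0$ real and $\sum_{j=1}^\ell m_j=1$, and a unique bijective conformal map $\Phi:\mathcal{K}\to\mathcal{L}$ with $\Phi(z)=z+O(1/z)$ near infinity. $\Phi$ extends to a continuous bijection $\overline{\mathcal{K}}\to\overline{\mathcal{L}}$ (also denoted $\Phi$), and for each $j$ the image $\Phi(\Gamma_j)$ contains $a_j$ in its interior. Logarithm. In the definition of $f$, the logarithm is the branch with $\log(1)=0$: for each $j$, $\log\frac{\Phi(z)-a_j}{z-\alpha_j}$ is the single-valued analytic branch in $\mathcal{K}$ (including $\infty$) that vanishes at $\infty$, extended continuously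 to $\Gamma$. The functions $\mu_j,h_j,f_j$ (known result). For each $\gamma_j$ there exist a unique real-valued (Hölder continuous) function $\mu_j$ and a unique piecewise constant real-valued function $h_j=(h_{1,j},\ldots,h_{\ell,j})$ on $J$ such that $$f_j(\eta(t))=\gamma_j(t)+h_j(t)+\mathrm{i}\mu_j(t),\quad t\in J,$$ are the boundary values of an analytic function $f_j$ in $\mathcal{K}$ with $f_j(\infty)=0$. (With $N(s,t)=\frac1\pi\operatorname{Im}\frac{\dot\eta(t)}{\eta(t)-\eta(s)}$, $M(s,t)=\frac1\pi\operatorname{Re}\frac{\dot\eta(t)}{\eta(t)-\eta(s)}$ and the corresponding integral operators $\mathbf{N}\mu(s)=\int_JN(s,t)\mu(t)\,dt$, $\mathbf{M}\mu(s)=\int_JM(s,t)\mu(t)\,dt$, the latter singular, $\mu_j$ is the unique solution of $(\mathbf{I}-\mathbf{N})\mu_j=-\mathbf{M}\gamma_j$, and $h_j=[\mathbf{M}\mu_j-(\mathbf{I}-\mathbf{N})\gamma_j]/2$.) *)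

theory Defs
  imports "HOL-Analysis.Analysis" "HOL-Library.Landau_Symbols"
begin

text \<open>
  The extended plane is the one-point compactification of the complex plane: \<open>None\<close> is the
  point at infinity and \<open>Some z\<close> is the finite point \<open>z\<close>.
\<close>

abbreviation sphere_top :: "complex option topology" where
  "sphere_top \<equiv> Alexandroff_compactification euclidean"

text \<open>The inversion \<open>z \<mapsto> 1/z\<close> of the extended plane.\<close>

definition sphere_inverse :: "complex option \<Rightarrow> complex option" where
  "sphere_inverse p =
     (case p of None \<Rightarrow> Some 0 | Some z \<Rightarrow> if z = 0 then None else Some (1 / z))"

text \<open>
  An involution carrying the local coordinate at \<open>p\<close>: the identity if \<open>p\<close> is finite and the
  inversion if \<open>p\<close> is infinity. It serves both as chart and as its inverse.
\<close>

definition sphere_chart :: "complex option \<Rightarrow> complex option \<Rightarrow> complex option" where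
  "sphere_chart p = (if p = None then sphere_inverse else id)"

definition sphere_analytic :: "(complex option \<Rightarrow> complex) \<Rightarrow> complex option set \<Rightarrow> bool" where
  "sphere_analytic f K \<longleftrightarrow>
     (\<forall>p\<in>K. (\<lambda>z. f (sphere_chart p (Some z))) analytic_on {the (sphere_chart p p)})"

definition continuous_on_closure :: "(complex option \<Rightarrow> complex) \<Rightarrow> complex option set \<Rightarrow> bool" where
  "continuous_on_closure f K \<longleftrightarrow>
     continuous_map (subtopology sphere_top (sphere_top closure_of K)) euclidean f"

text \<open>
  Continuity is required separately because \<open>the\<close> is unspecified on \<open>None\<close>; with it, the
  coordinate expression below is meaningful near each point.
\<close>

definition conformal_bijection ::
  "(complex option \<Rightarrow> complex option) \<Rightarrow> complex option set \<Rightarrow> complex option set \<Rightarrow> bool" where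
  "conformal_bijection \<Phi> K L \<longleftrightarrow>
     bij_betw \<Phi> K L \<and>
     continuous_map (subtopology sphere_top K) sphere_top \<Phi> \<and>
     (\<forall>p\<in>K. (\<lambda>z. the (sphere_chart (\<Phi> p) (\<Phi> (sphere_chart p (Some z)))))
               analytic_on {the (sphere_chart p p)})"

text \<open>
  The disjoint union \<open>J\<close> of \<open>l\<close> copies of \<open>[0, 2\<pi>]\<close> is a set of pairs (component, parameter), and
  \<open>\<eta> (k, \<cdot>)\<close>, defined on the whole real line, is the periodic parametrization of the \<open>k\<close>-th curve.
\<close>

definition param_set :: "nat \<Rightarrow> (nat \<times> real) set" where
  "param_set l = {1..l} \<times> {0..2 * pi}"

definition bcurve :: "(nat \<times> real \<Rightarrow> complex) \<Rightarrow> nat \<Rightarrow> complex set" where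
  "bcurve \<eta> k = (\<lambda>t. \<eta> (k, t)) ` {0..2 * pi}"

definition regular_periodic_C2 :: "(real \<Rightarrow> complex) \<Rightarrow> bool" where
  "regular_periodic_C2 g \<longleftrightarrow>
     (\<forall>t. g (t + 2 * pi) = g t) \<and>
     (\<exists>g' g''. (\<forall>t. (g has_vector_derivative g' t) (at t)) \<and>
               (\<forall>t. (g' has_vector_derivative g'' t) (at t)) \<and>
               continuous_on UNIV g'' \<and>
               (\<forall>t. g' t \<noteq> 0))"

text \<open>
  In the last conjunct, \<open>\<i> * \<eta>'\<close> is the left normal of the oriented curve: it says that \<open>K\<close> lies to
  the left of its boundary.
\<close>

definition smooth_domain ::
  "complex option set \<Rightarrow> nat \<Rightarrow> (nat \<times> real \<Rightarrow> complex) \<Rightarrow> bool" where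
  "smooth_domain K l \<eta> \<longleftrightarrow>
     openin sphere_top K \<and> connectedin sphere_top K \<and> None \<in> K \<and> 1 \<le> l \<and>
     (\<forall>k\<in>{1..l}. regular_periodic_C2 (\<lambda>t. \<eta> (k, t)) \<and>
        simple_path (\<lambda>s. \<eta> (k, 2 * pi * s)) \<and> \<eta> (k, 2 * pi) = \<eta> (k, 0)) \<and>
     (\<forall>j\<in>{1..l}. \<forall>k\<in>{1..l}. j \<noteq> k \<longrightarrow> bcurve \<eta> j \<inter> bcurve \<eta> k = {}) \<and>
     sphere_top frontier_of K = Some ` (\<Union>k\<in>{1..l}. bcurve \<eta> k) \<and>
     (\<forall>k\<in>{1..l}. \<forall>t. \<forall>\<^sub>F \<epsilon> in at_right (0::real).
        Some (\<eta> (k, t) + of_real \<epsilon> * \<i> * vector_derivative (\<lambda>s. \<eta> (k, s)) (at t)) \<in> K)"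

definition lemniscatic_domain ::
  "nat \<Rightarrow> (nat \<Rightarrow> complex) \<Rightarrow> (nat \<Rightarrow> real) \<Rightarrow> real \<Rightarrow> complex option set" where
  "lemniscatic_domain l a m \<tau> =
     insert None (Some ` {w. (\<Prod>j = 1..l. cmod (w - a j) powr m j) > \<tau>})"

text \<open>
  \<open>\<Phi>\<close> is the map of Walsh's theorem together with its continuous extension to the closure of \<open>K\<close>.
  The last conjunct fixes the numbering of the centres \<open>a j\<close> relative to the boundary curves.
\<close>

definition walsh_map ::
  "complex option set \<Rightarrow> nat \<Rightarrow> (nat \<times> real \<Rightarrow> complex) \<Rightarrow> (complex option \<Rightarrow> complex option) \<Rightarrow>
   (nat \<Rightarrow> complex) \<Rightarrow> (nat \<Rightarrow> real) \<Rightarrow> real \<Rightarrow> bool" where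
  "walsh_map K l \<eta> \<Phi> a m \<tau> \<longleftrightarrow>
     inj_on a {1..l} \<and> (\<forall>j\<in>{1..l}. m j > 0) \<and> (\<Sum>j = 1..l. m j) = 1 \<and> \<tau> > 0 \<and>
     conformal_bijection \<Phi> K (lemniscatic_domain l a m \<tau>) \<and>
     \<Phi> None = None \<and>
     (\<lambda>z. the (\<Phi> (Some z)) - z) \<in> O[at_infinity](\<lambda>z. 1 / z) \<and>
     continuous_map (subtopology sphere_top (sphere_top closure_of K)) sphere_top \<Phi> \<and>
     bij_betw \<Phi> (sphere_top closure_of K) (sphere_top closure_of lemniscatic_domain l a m \<tau>) \<and>
     (\<forall>j\<in>{1..l}. a j \<in> inside ((\<lambda>z. the (\<Phi> (Some z))) ` bcurve \<eta> j))"

text \<open>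
  \<open>Lg\<close> is the single-valued analytic branch of \<open>log ((\<Phi> z - a) / (z - \<alpha>))\<close> in \<open>K\<close> vanishing at
  infinity, extended continuously to the boundary; these conditions determine it on the closure.
\<close>

definition log_quotient_branch ::
  "complex option set \<Rightarrow> (complex option \<Rightarrow> complex option) \<Rightarrow> complex \<Rightarrow> complex \<Rightarrow>
   (complex option \<Rightarrow> complex) \<Rightarrow> bool" where
  "log_quotient_branch K \<Phi> a \<alpha> Lg \<longleftrightarrow>
     sphere_analytic Lg K \<and> continuous_on_closure Lg K \<and> Lg None = 0 \<and>
     (\<forall>z. Some z \<in> K \<longrightarrow> exp (Lg (Some z)) = (the (\<Phi> (Some z)) - a) / (z - \<alpha>))"

definition piecewise_constant :: "nat \<Rightarrow> (nat \<times> real \<Rightarrow> real) \<Rightarrow> bool" where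
  "piecewise_constant l h \<longleftrightarrow> (\<exists>c. \<forall>(k, t)\<in>param_set l. h (k, t) = c k)"

definition hoelder_continuous :: "nat \<Rightarrow> (nat \<times> real \<Rightarrow> real) \<Rightarrow> bool" where
  "hoelder_continuous l \<mu> \<longleftrightarrow>
     (\<exists>\<beta> C. 0 < \<beta> \<and> \<beta> \<le> 1 \<and>
        (\<forall>k\<in>{1..l}. \<forall>s\<in>{0..2 * pi}. \<forall>t\<in>{0..2 * pi}.
           \<bar>\<mu> (k, s) - \<mu> (k, t)\<bar> \<le> C * \<bar>s - t\<bar> powr \<beta>))"

text \<open>
  \<open>\<gamma> + h + \<i> \<mu>\<close> are the boundary values of the function \<open>F\<close>, analytic in \<open>K\<close> with value \<open>0\<close> at
  infinity; \<open>F\<close> includes its continuous extension to the boundary.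
\<close>

definition boundary_problem_solution ::
  "complex option set \<Rightarrow> nat \<Rightarrow> (nat \<times> real \<Rightarrow> complex) \<Rightarrow> (nat \<times> real \<Rightarrow> real) \<Rightarrow>
   (nat \<times> real \<Rightarrow> real) \<Rightarrow> (nat \<times> real \<Rightarrow> real) \<Rightarrow> (complex option \<Rightarrow> complex) \<Rightarrow> bool" where
  "boundary_problem_solution K l \<eta> \<gamma> \<mu> h F \<longleftrightarrow>
     hoelder_continuous l \<mu> \<and> piecewise_constant l h \<and>
     sphere_analytic F K \<and> continuous_on_closure F K \<and> F None = 0 \<and>
     (\<forall>t\<in>param_set l. F (Some (\<eta> t)) = of_real (\<gamma> t) + of_real (h t) + \<i> * of_real (\<mu> t))"

end

theory Submission
  imports Defs "HOL-Complex_Analysis.Conformal_Mappings"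
begin

text \<open>
  The difference \<open>g = f - \<Sum>j. m j * F j\<close> is analytic in \<open>K\<close>, vanishes at infinity, and has
  constant real part on each boundary curve. If \<open>g\<close> were not constant, its image would be open and
  so contain values with a real part \<open>x\<close> different from these finitely many constants and from
  \<open>0\<close>. The points of the closure where \<open>Re g = x\<close> form a compact subset of \<open>K\<close>; where
  \<open>Im g\<close> is maximal among them, the open mapping theorem is violated. Hence \<open>g = 0\<close> on the closure,
  and all three identities follow. The boundary values of \<open>f\<close> come from the fact that \<open>\<Phi>\<close> maps
  the boundary of \<open>K\<close> into the level set where \<open>\<Prod>j. cmod (w - a j) powr m j = \<tau>\<close>.
\<close>

section \<open>Passing between the extended plane and its finite part\<close>

lemma open_vimage_Some_sphere:
  assumes "openin sphere_top U"
  shows "open (Some -` U)"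
proof -
  consider V where "open V" "U = Some ` V"
    | C where "compact C" "U = insert None (Some ` (- C))"
    using assms by (auto simp: openin_Alexandroff_compactification Compl_eq_Diff_UNIV)
  then show ?thesis
  proof cases
    case 1
    then have "Some -` U = V" by auto
    then show ?thesis using 1 by simp
  next
    case 2
    then have "Some -` U = - C" by auto
    then show ?thesis using 2 by (simp add: compact_imp_closed open_Compl)
  qed
qed

lemma bounded_Compl_vimage_Some_sphere:
  assumes "openin sphere_top U" "None \<in> U"
  shows "bounded (- (Some -` U))"
proof -
  obtain C where C: "compact C" "U = insert None (Some ` (- C))"
    using assms by (auto simp: openin_Alexandroff_compactification Compl_eq_Diff_UNIV)
  then have "- (Some -` U) \<subseteq> C" by auto
  then show ?thesis using C compact_imp_bounded bounded_subset by blast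
qed

lemma openin_sphere_Some_image: "open V \<Longrightarrow> openin sphere_top (Some ` V)"
  by (auto simp: openin_Alexandroff_compactification)

text \<open>The plane is an open subspace of the sphere: \<open>Some\<close> sends open sets to open
  sets and pulls them back to open sets. So small neighbourhoods of a finite point never see
  infinity, whether or not \<open>S\<close> contains it.\<close>

lemma Some_in_sphere_closure_iff:
  "Some z \<in> sphere_top closure_of S \<longleftrightarrow> z \<in> closure (Some -` S)"
proof
  assume L: "Some z \<in> sphere_top closure_of S"
  show "z \<in> closure (Some -` S)"
    unfolding closure_iff_nhds_not_empty
  proof (intro allI impI)
    fix B V assume "V \<subseteq> B" "open V" "z \<in> V"
    then have "\<exists>y. y \<in> S \<and> y \<in> Some ` V"
      using L openin_sphere_Some_image[of V] unfolding in_closure_of by blast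
    with \<open>V \<subseteq> B\<close> show "Some -` S \<inter> B \<noteq> {}" by auto
  qed
next
  assume R: "z \<in> closure (Some -` S)"
  have "\<exists>y. y \<in> S \<and> y \<in> T" if T: "Some z \<in> T" "openin sphere_top T" for T
  proof -
    have "Some -` S \<inter> Some -` T \<noteq> {}"
      using R T open_vimage_Some_sphere[of T] unfolding closure_iff_nhds_not_empty
      by (metis order_refl vimageI)
    then show ?thesis by auto
  qed
  then show "Some z \<in> sphere_top closure_of S"
    by (auto simp: in_closure_of)
qed

lemma Some_in_sphere_frontier_iff:
  assumes "openin sphere_top S"
  shows "Some z \<in> sphere_top frontier_of S \<longleftrightarrow> z \<in> closure (Some -` S) - Some -` S"
  using assms by (auto simp: frontier_of_openin Some_in_sphere_closure_iff)

text \<open>Composing with this embedding turns continuity on the closure in the sphere into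
  ordinary continuity on a closed subset of the plane.\<close>

lemma continuous_map_Some_closure:
  "continuous_map (top_of_set (closure (Some -` S)))
     (subtopology sphere_top (sphere_top closure_of S)) Some"
proof -
  have "continuous_map euclidean sphere_top Some"
    unfolding continuous_map_def
    using open_vimage_Some_sphere by (auto simp: vimage_def)
  then show ?thesis
    by (auto simp: continuous_map_in_subtopology continuous_map_from_subtopology
        Some_in_sphere_closure_iff)
qed

lemma continuous_on_closure_finite_part:
  assumes "continuous_on_closure F S"
  shows "continuous_on (closure (Some -` S)) (\<lambda>z. F (Some z))"
proof -
  have "continuous_map (top_of_set (closure (Some -` S))) euclidean (F \<circ> Some)"
    using assms continuous_map_Some_closure continuous_map_compose
    unfolding continuous_on_closure_def by blast
  then show ?thesis by (simp add: o_def)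
qed

text \<open>Continuity at infinity in planar terms: \<open>F\<close> is within \<open>e\<close> of
  its value at infinity on a neighbourhood of \<open>None\<close>, and the finite complement of such
  a neighbourhood is bounded.\<close>

lemma continuous_on_closure_bounded_level:
  assumes F: "continuous_on_closure F S" and "None \<in> S" and "e > 0"
  shows "bounded {z \<in> closure (Some -` S). e \<le> dist (F (Some z)) (F None)}"
proof -
  let ?cl = "sphere_top closure_of S"
  have N: "None \<in> ?cl"
    using \<open>None \<in> S\<close> by (simp add: in_closure_of) blast
  have "openin (subtopology sphere_top ?cl)
      {p \<in> topspace (subtopology sphere_top ?cl). F p \<in> ball (F None) e}"
    using F unfolding continuous_on_closure_def
    by (rule openin_continuous_map_preimage) simp
  then obtain T where T: "openin sphere_top T"
    "{p \<in> topspace (subtopology sphere_top ?cl). F p \<in> ball (F None) e} = T \<inter> ?cl"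
    unfolding openin_subtopology by blast
  have "None \<in> T \<inter> ?cl" unfolding T(2)[symmetric] using N \<open>e > 0\<close> by simp
  then have "None \<in> T" by simp
  moreover have "{z \<in> closure (Some -` S). e \<le> dist (F (Some z)) (F None)} \<subseteq> - (Some -` T)"
  proof safe
    fix z assume "z \<in> closure (Some -` S)" "e \<le> dist (F (Some z)) (F None)" "Some z \<in> T"
    moreover from this have "Some z \<in> T \<inter> ?cl" by (simp add: Some_in_sphere_closure_iff)
    ultimately show False unfolding T(2)[symmetric] by (simp add: dist_commute)
  qed
  ultimately show ?thesis
    using bounded_Compl_vimage_Some_sphere[OF T(1)] bounded_subset by blast
qed

text \<open>
  The part of \<open>K\<close> outside a large disc is connected, so in a separation of \<open>K\<close> without infinity
  it lies on one side, to which infinity can then be added.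
\<close>

lemma connected_vimage_Some_sphere:
  assumes op: "openin sphere_top S" and con: "connectedin sphere_top S" and N: "None \<in> S"
  shows "connected (Some -` S)"
proof (rule ccontr)
  assume nc: "\<not> connected (Some -` S)"
  have oA: "open (Some -` S)" using op by (rule open_vimage_Some_sphere)
  obtain E1 E2 where E: "open E1" "open E2" "E1 \<union> E2 = Some -` S" "E1 \<inter> E2 = {}"
      "E1 \<noteq> {}" "E2 \<noteq> {}"
    using nc oA unfolding connected_openin_eq openin_open_eq[OF oA] by blast
  obtain R where R: "- (Some -` S) \<subseteq> cball 0 R"
    using bounded_Compl_vimage_Some_sphere[OF op N] by (auto simp: bounded_iff subset_iff)
  have split: False
    if E: "open E1" "open E2" "E1 \<union> E2 = Some -` S" "E1 \<inter> E2 = {}" "E2 \<noteq> {}"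
      and far: "- cball 0 R \<subseteq> E1" for E1 E2
  proof -
    have "closed (- E1)" using E(1) by (simp add: closed_Compl)
    moreover have "bounded (- E1)" using far by (intro bounded_subset[OF bounded_cball[of 0 R]]) auto
    ultimately have "compact (- E1)" by (simp add: compact_eq_bounded_closed)
    then have "openin sphere_top (insert None (Some ` E1))"
      unfolding openin_Alexandroff_compactification
      by (intro disjI2 exI[of _ "- E1"]) (use E(1) in auto)
    moreover have "openin sphere_top (Some ` E2)" using E(2) by (rule openin_sphere_Some_image)
    moreover have "S \<subseteq> insert None (Some ` E1) \<union> Some ` E2"
    proof
      fix p assume "p \<in> S"
      then show "p \<in> insert None (Some ` E1) \<union> Some ` E2"
        using E(3) by (cases p) auto
    qed
    moreover have "insert None (Some ` E1) \<inter> Some ` E2 \<inter> S = {}" using E(4) by auto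
    moreover have "insert None (Some ` E1) \<inter> S \<noteq> {}" using N by auto
    moreover have "Some ` E2 \<inter> S \<noteq> {}" using E(3,5) by auto
    ultimately show False using con unfolding connectedin by blast
  qed
  have "connected (- cball (0::complex) R)"
    by (rule connected_complement_bounded_convex) auto
  moreover have "- cball 0 R \<subseteq> E1 \<union> E2" using R E(3) by auto
  ultimately have "- cball 0 R \<subseteq> E1 \<or> - cball 0 R \<subseteq> E2"
    using E(1,2,4) connectedD[of "- cball 0 R" E1 E2] by blast
  then show False
    using split[of E1 E2] split[of E2 E1] E by (auto simp: Int_commute Un_commute)
qed

section \<open>Restrictions and linear combinations of analytic functions\<close>

lemma sphere_analytic_finite_part:
  assumes "sphere_analytic F S"
  shows "(\<lambda>z. F (Some z)) analytic_on Some -` S"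
proof -
  have "(\<lambda>z. F (Some z)) analytic_on {w}" if "w \<in> Some -` S" for w
    using assms that unfolding sphere_analytic_def sphere_chart_def by force
  then show ?thesis using analytic_on_analytic_at by blast
qed

lemma sphere_analytic_weighted_sum:
  assumes "\<And>j. j \<in> I \<Longrightarrow> sphere_analytic (F j) S"
  shows "sphere_analytic (\<lambda>z. \<Sum>j\<in>I. c j * F j z) S"
  unfolding sphere_analytic_def
proof
  fix p assume "p \<in> S"
  then have "(\<lambda>z. c j * F j (sphere_chart p (Some z))) analytic_on {the (sphere_chart p p)}"
    if "j \<in> I" for j
    using assms[OF that] analytic_on_mult[OF analytic_on_const] unfolding sphere_analytic_def by blast
  then show "(\<lambda>z. \<Sum>j\<in>I. c j * F j (sphere_chart p (Some z)))
      analytic_on {the (sphere_chart p p)}"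
    by (rule analytic_on_sum)
qed

lemma continuous_on_closure_weighted_sum:
  assumes "finite I" "\<And>j. j \<in> I \<Longrightarrow> continuous_on_closure (F j) S"
  shows "continuous_on_closure (\<lambda>z. \<Sum>j\<in>I. c j * F j z) S"
  using assms unfolding continuous_on_closure_def
  by (intro continuous_map_sum) (simp_all add: continuous_map_atin tendsto_mult_left)

lemma continuous_on_closure_diff:
  assumes "continuous_on_closure F S" "continuous_on_closure G S"
  shows "continuous_on_closure (\<lambda>z. F z - G z) S"
  using assms unfolding continuous_on_closure_def by (rule continuous_map_diff)

section \<open>Uniqueness for the boundary value problem\<close>

text \<open>The boundary values of the real part may be unknown and differ from curve to curve; what
  matters is that there are finitely many, so that a level of \<open>Re g\<close> can avoid them
  all. The hypothesis \<open>lim\<close> says that \<open>g\<close> tends to 0 at infinity.\<close>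

lemma holomorphic_Re_boundary_finite_imp_zero:
  fixes g :: "complex \<Rightarrow> complex"
  assumes A: "open A" "connected A" "\<not> bounded A"
    and hol: "g holomorphic_on A" and cont: "continuous_on (closure A) g"
    and C: "finite C" "\<And>z. z \<in> closure A - A \<Longrightarrow> Re (g z) \<in> C"
    and lim: "\<And>e. e > 0 \<Longrightarrow> bounded {z \<in> closure A. e \<le> cmod (g z)}"
    and z: "z \<in> closure A"
  shows "g z = 0"
proof -
  have "g constant_on A"
  proof (rule ccontr)
    assume nc: "\<not> g constant_on A"
    have opn: "open (g ` A)" using open_mapping_thm[OF hol A(1,2,1) order_refl nc] .
    obtain w where w: "w \<in> g ` A" using A(3) by fastforce
    then obtain e where e: "e > 0" "ball w e \<subseteq> g ` A"
      using opn openE by blast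
    \<comment> \<open>Avoiding 0 makes the level set \<open>T\<close> bounded by \<open>lim\<close>;
      avoiding \<open>C\<close> keeps \<open>T\<close> off the boundary.\<close>
    have "infinite {Re w<..<Re w + e}" using e(1) by (simp add: infinite_Ioo)
    then obtain x where x: "x \<in> {Re w<..<Re w + e}" "x \<notin> insert 0 C"
      using C(1) by (meson finite.insertI finite_subset subsetI)
    have "Complex x (Im w) \<in> ball w e"
      using x(1) by (simp add: dist_norm cmod_def)
    then obtain z0 where z0: "z0 \<in> A" "Re (g z0) = x"
      using e(2) by (metis complex.sel(1) imageE subsetD)
    define T where "T = {z \<in> closure A. Re (g z) = x}"
    have "T \<subseteq> {z \<in> closure A. \<bar>x\<bar> \<le> cmod (g z)}"
      unfolding T_def using abs_Re_le_cmod by blast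
    moreover have "bounded {z \<in> closure A. \<bar>x\<bar> \<le> cmod (g z)}" using lim x(2) by simp
    ultimately have "bounded T" by (rule bounded_subset[rotated])
    moreover have "closed T"
      unfolding T_def
      by (intro continuous_closed_preimage_constant continuous_intros cont closed_closure)
    ultimately have "compact T" by (simp add: compact_eq_bounded_closed)
    moreover have "T \<noteq> {}" unfolding T_def using z0 closure_subset by blast
    moreover have "continuous_on T (\<lambda>z. Im (g z))"
      by (intro continuous_intros continuous_on_subset[OF cont]) (auto simp: T_def)
    ultimately obtain q where q: "q \<in> T" "\<And>z. z \<in> T \<Longrightarrow> Im (g z) \<le> Im (g q)"
      using continuous_attains_sup by metis
    have "q \<in> A" using q(1) C(2) x(2) unfolding T_def by blast
    then obtain d where d: "d > 0" "ball (g q) d \<subseteq> g ` A"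
      using opn openE by (metis imageI)
    \<comment> \<open>A purely imaginary shift keeps the real part equal to \<open>x\<close>, so its
      preimage \<open>q'\<close> lies in \<open>T\<close> again, with a larger imaginary part than
      the maximal one.\<close>
    have "g q + \<i> * of_real (d / 2) \<in> ball (g q) d"
      using d(1) by (simp add: dist_norm norm_mult)
    then obtain q' where q': "q' \<in> A" "g q' = g q + \<i> * of_real (d / 2)"
      using d(2) by (metis imageE subsetD)
    then have "q' \<in> T" using q(1) closure_subset by (auto simp: T_def)
    then show False using q(2)[of q'] q'(2) d(1) by simp
  qed
  then obtain c where c: "\<And>z. z \<in> A \<Longrightarrow> g z = c" unfolding constant_on_def by blast
  \<comment> \<open>A nonzero constant would place all of the unbounded set \<open>A\<close> in one
    of the sets that \<open>lim\<close> bounds.\<close>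
  have "c = 0"
  proof (rule ccontr)
    assume "c \<noteq> 0"
    then have "bounded {z \<in> closure A. cmod c \<le> cmod (g z)}" using lim by simp
    moreover have "A \<subseteq> {z \<in> closure A. cmod c \<le> cmod (g z)}" using c closure_subset by auto
    ultimately show False using A(3) bounded_subset by blast
  qed
  then show ?thesis using continuous_constant_on_closure[OF cont _ z] c by blast
qed

section \<open>Boundary behaviour of the Walsh map\<close>

text \<open>Injectivity on the closure together with \<open>\<Phi> None = None\<close> prevents a
  finite point from going to infinity. Hence \<open>the\<close> is never applied to
  \<open>None\<close> here, and the planar form of \<open>\<Phi>\<close> inherits
  continuity.\<close>

lemma walsh_map_finite_part:
  assumes \<Phi>: "walsh_map K l \<eta> \<Phi> a m \<tau>" and N: "None \<in> K"
  shows "\<And>z. z \<in> closure (Some -` K) \<Longrightarrow> \<Phi> (Some z) \<noteq> None"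
    and "continuous_on (closure (Some -` K)) (\<lambda>z. the (\<Phi> (Some z)))"
proof -
  let ?cl = "sphere_top closure_of K" and ?A = "Some -` K"
  have inj: "inj_on \<Phi> ?cl" and \<Phi>N: "\<Phi> None = None"
    and cm: "continuous_map (subtopology sphere_top ?cl) sphere_top \<Phi>"
    using \<Phi> by (auto simp: walsh_map_def bij_betw_def)
  have Ncl: "None \<in> ?cl"
    using N by (simp add: in_closure_of) blast
  show fin: "\<Phi> (Some z) \<noteq> None" if "z \<in> closure ?A" for z
    using inj_onD[OF inj, of "Some z" None] that Ncl \<Phi>N by (auto simp: Some_in_sphere_closure_iff)
  have comp: "continuous_map (top_of_set (closure ?A)) sphere_top (\<Phi> \<circ> Some)"
    using cm continuous_map_Some_closure continuous_map_compose by blast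
  show "continuous_on (closure ?A) (\<lambda>z. the (\<Phi> (Some z)))"
    unfolding continuous_openin_preimage_eq
  proof (intro allI impI)
    fix V :: "complex set" assume "open V"
    then have "openin (top_of_set (closure ?A))
        {z \<in> topspace (top_of_set (closure ?A)). (\<Phi> \<circ> Some) z \<in> Some ` V}"
      using comp openin_sphere_Some_image openin_continuous_map_preimage by blast
    moreover have "{z \<in> topspace (top_of_set (closure ?A)). (\<Phi> \<circ> Some) z \<in> Some ` V} =
        closure ?A \<inter> (\<lambda>z. the (\<Phi> (Some z))) -` V"
      using fin by force
    ultimately show "openin (top_of_set (closure ?A))
        (closure ?A \<inter> (\<lambda>z. the (\<Phi> (Some z))) -` V)" by simp
  qed
qed

text \<open>A boundary point cannot be sent into the lemniscatic domain, since every point there is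
  already the image of a point of \<open>K\<close> and \<open>\<Phi>\<close> is injective on the
  closure; this gives one inequality. The other is the limit of the strict inequality valid on
  \<open>K\<close>.\<close>

lemma walsh_map_boundary_level:
  assumes \<Phi>: "walsh_map K l \<eta> \<Phi> a m \<tau>" and N: "None \<in> K"
    and z: "z \<in> closure (Some -` K) - Some -` K"
  shows "(\<Prod>j = 1..l. cmod (the (\<Phi> (Some z)) - a j) powr m j) = \<tau>"
proof (rule antisym)
  let ?L = "lemniscatic_domain l a m \<tau>"
  let ?P = "\<lambda>z. \<Prod>j = 1..l. cmod (the (\<Phi> (Some z)) - a j) powr m j"
  have inj: "inj_on \<Phi> (sphere_top closure_of K)" and bij: "bij_betw \<Phi> K ?L"
    and m: "\<And>j. j \<in> {1..l} \<Longrightarrow> m j > 0"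
    using \<Phi> by (auto simp: walsh_map_def bij_betw_def conformal_bijection_def)
  have fin: "\<Phi> (Some w) = Some (the (\<Phi> (Some w)))" if "w \<in> closure (Some -` K)" for w
    using walsh_map_finite_part(1)[OF \<Phi> N that] by simp
  have sub: "K \<subseteq> sphere_top closure_of K"
    by (rule closure_of_subset) (auto intro: option.exhaust)
  have "\<Phi> (Some z) \<notin> ?L"
  proof
    assume "\<Phi> (Some z) \<in> ?L"
    then obtain p where p: "p \<in> K" "\<Phi> p = \<Phi> (Some z)"
      using bij by (metis bij_betw_imp_surj_on imageE)
    then have "p = Some z"
      using inj_onD[OF inj, of p "Some z"] sub z by (auto simp: Some_in_sphere_closure_iff)
    then show False using p z by auto
  qed
  then show "?P z \<le> \<tau>"
    using fin[of z] z unfolding lemniscatic_domain_def by (force simp: not_less)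
  have "?P w \<ge> \<tau>" if "w \<in> Some -` K" for w
  proof -
    have "\<Phi> (Some w) \<in> ?L" using bij that bij_betwE by fastforce
    moreover have "\<Phi> (Some w) = Some (the (\<Phi> (Some w)))" using fin that closure_subset by blast
    ultimately show ?thesis unfolding lemniscatic_domain_def by force
  qed
  \<comment> \<open>Positivity of the exponents \<open>m j\<close> gives continuity even where a
    base vanishes.\<close>
  moreover have "continuous_on (closure (Some -` K)) ?P"
    using m by (intro continuous_on_prod continuous_on_powr' continuous_intros
        walsh_map_finite_part(2)[OF \<Phi> N]) auto
  ultimately show "\<tau> \<le> ?P z" using continuous_ge_on_closure[of "Some -` K" ?P z \<tau>] z by blast
qed

text \<open>The exponential identity is assumed only on \<open>K\<close>. With the denominator
  cleared it extends by continuity to the closure without knowing beforehand that \<open>z\<close>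
  differs from \<open>\<alpha>\<close>; taking moduli and logarithms then gives the real
  part.\<close>

lemma Re_log_quotient_boundary:
  assumes \<Phi>: "walsh_map K l \<eta> \<Phi> a m \<tau>" and N: "None \<in> K"
    and Lg: "log_quotient_branch K \<Phi> (a j) \<alpha> L"
    and j: "j \<in> {1..l}" and z: "z \<in> closure (Some -` K) - Some -` K"
  shows "Re (L (Some z)) = ln (cmod (the (\<Phi> (Some z)) - a j)) - ln (cmod (z - \<alpha>))"
    and "the (\<Phi> (Some z)) \<noteq> a j"
proof -
  let ?P = "\<lambda>z. the (\<Phi> (Some z))"
  show ne: "?P z \<noteq> a j"
  proof
    assume "?P z = a j"
    then have "(\<Prod>i = 1..l. cmod (?P z - a i) powr m i) = 0"
      by (intro prod_zero bexI[of _ j] j) auto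
    moreover have "\<tau> > 0" using \<Phi> by (simp add: walsh_map_def)
    ultimately show False using walsh_map_boundary_level[OF \<Phi> N z] by linarith
  qed
  have "exp (L (Some w)) * (w - \<alpha>) - (?P w - a j) = 0" if "w \<in> Some -` K" for w
  proof -
    have e: "exp (L (Some w)) = (?P w - a j) / (w - \<alpha>)"
      using Lg that by (simp add: log_quotient_branch_def)
    \<comment> \<open>At \<open>w = \<alpha>\<close> the quotient would be 0, the value of division
      by zero, whereas \<open>exp\<close> never vanishes.\<close>
    moreover have "w \<noteq> \<alpha>" using e by auto
    ultimately show ?thesis by simp
  qed
  moreover have "continuous_on (closure (Some -` K))
      (\<lambda>w. exp (L (Some w)) * (w - \<alpha>) - (?P w - a j))"
    using Lg unfolding log_quotient_branch_def
    by (intro continuous_intros continuous_on_closure_finite_part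
        walsh_map_finite_part(2)[OF \<Phi> N]) auto
  ultimately have eq: "exp (L (Some z)) * (z - \<alpha>) = ?P z - a j"
    using continuous_constant_on_closure[of "Some -` K"
        "\<lambda>w. exp (L (Some w)) * (w - \<alpha>) - (?P w - a j)" 0 z] z by auto
  then have "z \<noteq> \<alpha>" using ne by auto
  have "cmod (?P z - a j) = exp (Re (L (Some z))) * cmod (z - \<alpha>)"
    unfolding eq[symmetric] by (simp add: norm_mult)
  then have "ln (cmod (?P z - a j)) = Re (L (Some z)) + ln (cmod (z - \<alpha>))"
    using \<open>z \<noteq> \<alpha>\<close> by (simp add: ln_mult)
  then show "Re (L (Some z)) = ln (cmod (?P z - a j)) - ln (cmod (z - \<alpha>))" by simp
qed

section \<open>Comparison of \<open>f\<close> with the weighted sum of the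
  \<open>F j\<close>\<close>

theorem theorem4p2:
  fixes K :: "complex option set" and l :: nat and \<eta> :: "nat \<times> real \<Rightarrow> complex"
    and \<Phi> :: "complex option \<Rightarrow> complex option"
    and a \<alpha> :: "nat \<Rightarrow> complex" and m :: "nat \<Rightarrow> real" and \<tau> :: real
    and Lg F :: "nat \<Rightarrow> complex option \<Rightarrow> complex"
    and f :: "complex option \<Rightarrow> complex"
    and \<gamma> \<mu> :: "nat \<times> real \<Rightarrow> real"
    and \<gamma>s \<mu>s h :: "nat \<Rightarrow> nat \<times> real \<Rightarrow> real"
  assumes K: "smooth_domain K l \<eta>"
    and \<Phi>: "walsh_map K l \<eta> \<Phi> a m \<tau>"
    and \<alpha>: "\<forall>j\<in>{1..l}. \<alpha> j \<in> inside (bcurve \<eta> j)"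
    and Lg: "\<forall>j\<in>{1..l}. log_quotient_branch K \<Phi> (a j) (\<alpha> j) (Lg j)"
    and f: "f = (\<lambda>z. \<Sum>j = 1..l. of_real (m j) * Lg j z)"
    and \<gamma>: "\<gamma> = (\<lambda>t. - (\<Sum>j = 1..l. m j * ln (cmod (\<eta> t - \<alpha> j))))"
    and \<mu>: "\<mu> = (\<lambda>t. Im (f (Some (\<eta> t))))"
    and \<gamma>s: "\<gamma>s = (\<lambda>j t. - ln (cmod (\<eta> t - \<alpha> j)))"
    and sol: "\<forall>j\<in>{1..l}. boundary_problem_solution K l \<eta> (\<gamma>s j) (\<mu>s j) (h j) (F j)"
  shows "(sphere_analytic f K \<and> f None = 0 \<and>
           (\<forall>t\<in>param_set l. f (Some (\<eta> t)) = of_real (ln \<tau> + \<gamma> t) + \<i> * of_real (\<mu> t))) \<and>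
         (\<forall>t\<in>param_set l. \<mu> t = (\<Sum>j = 1..l. m j * \<mu>s j t)) \<and>
         (\<forall>t\<in>param_set l. ln \<tau> = (\<Sum>j = 1..l. m j * h j t)) \<and>
         (\<forall>z\<in>K. f z = (\<Sum>j = 1..l. of_real (m j) * F j z))"
proof -
  have op: "openin sphere_top K" and con: "connectedin sphere_top K" and N: "None \<in> K"
    and fr: "sphere_top frontier_of K = Some ` (\<Union>k\<in>{1..l}. bcurve \<eta> k)"
    using K by (auto simp: smooth_domain_def)
  let ?A = "Some -` K"
  have bd: "z \<in> closure ?A - ?A \<longleftrightarrow> (\<exists>t\<in>param_set l. z = \<eta> t)" for z
    unfolding Some_in_sphere_frontier_iff[OF op, symmetric] fr
    by (force simp: bcurve_def param_set_def)
  define G where "G = (\<lambda>z. \<Sum>j = 1..l. of_real (m j) * F j z)"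
  have fan: "sphere_analytic f K" and fcont: "continuous_on_closure f K" and fN: "f None = 0"
    unfolding f using Lg
    by (auto simp: log_quotient_branch_def
        intro!: sphere_analytic_weighted_sum continuous_on_closure_weighted_sum)
  have Gan: "sphere_analytic G K" and Gcont: "continuous_on_closure G K" and GN: "G None = 0"
    unfolding G_def using sol
    by (auto simp: boundary_problem_solution_def
        intro!: sphere_analytic_weighted_sum continuous_on_closure_weighted_sum)
  have Ref: "Re (f (Some (\<eta> t))) = ln \<tau> + \<gamma> t" if t: "t \<in> param_set l" for t
  proof -
    let ?w = "the (\<Phi> (Some (\<eta> t)))"
    have z: "\<eta> t \<in> closure ?A - ?A" using bd t by blast
    have ne: "?w \<noteq> a j" if "j \<in> {1..l}" for j
      using Re_log_quotient_boundary(2)[OF \<Phi> N _ that z] Lg that by blast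
    have "ln \<tau> = ln (\<Prod>j = 1..l. cmod (?w - a j) powr m j)"
      using walsh_map_boundary_level[OF \<Phi> N z] by simp
    \<comment> \<open>The logarithm of the product splits because \<open>ne\<close> makes every
      factor positive.\<close>
    also have "\<dots> = (\<Sum>j = 1..l. m j * ln (cmod (?w - a j)))"
      using ne by (subst ln_prod) (auto simp: ln_powr)
    finally have "ln \<tau> = (\<Sum>j = 1..l. m j * ln (cmod (?w - a j)))" .
    moreover have "Re (f (Some (\<eta> t))) =
        (\<Sum>j = 1..l. m j * (ln (cmod (?w - a j)) - ln (cmod (\<eta> t - \<alpha> j))))"
    proof -
      have "Re (Lg j (Some (\<eta> t))) = ln (cmod (?w - a j)) - ln (cmod (\<eta> t - \<alpha> j))"
        if "j \<in> {1..l}" for j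
        using Re_log_quotient_boundary(1)[OF \<Phi> N _ that z] Lg that by blast
      then show ?thesis by (simp add: f)
    qed
    ultimately show ?thesis by (simp add: \<gamma> right_diff_distrib sum_subtractf)
  qed
  have ReG: "Re (G (Some (\<eta> t))) = \<gamma> t + (\<Sum>j = 1..l. m j * h j t)"
    and ImG: "Im (G (Some (\<eta> t))) = (\<Sum>j = 1..l. m j * \<mu>s j t)" if t: "t \<in> param_set l" for t
  proof -
    have F: "F j (Some (\<eta> t)) = of_real (\<gamma>s j t) + of_real (h j t) + \<i> * of_real (\<mu>s j t)"
      if "j \<in> {1..l}" for j
      using sol that t by (simp add: boundary_problem_solution_def)
    show "Re (G (Some (\<eta> t))) = \<gamma> t + (\<Sum>j = 1..l. m j * h j t)"
      by (simp add: G_def F \<gamma> \<gamma>s algebra_simps sum_subtractf)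
    show "Im (G (Some (\<eta> t))) = (\<Sum>j = 1..l. m j * \<mu>s j t)"
      by (simp add: G_def F)
  qed
  \<comment> \<open>One value \<open>c j k\<close> is chosen for each \<open>h j\<close> on each
    curve \<open>k\<close>, so that the finite set \<open>C\<close> of boundary values below can be
    written down.\<close>
  have "\<forall>j\<in>{1..l}. \<exists>c. \<forall>(k, t)\<in>param_set l. h j (k, t) = c k"
    using sol by (simp add: boundary_problem_solution_def piecewise_constant_def)
  from bchoice[OF this] obtain c
    where "\<forall>j\<in>{1..l}. \<forall>(k, t)\<in>param_set l. h j (k, t) = c j k" by blast
  then have c: "h j (k, t) = c j k" if "j \<in> {1..l}" "(k, t) \<in> param_set l" for j k t
    using that by fast
  \<comment> \<open>On the curve \<open>k\<close> the terms \<open>\<gamma>\<close> cancel from the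
    real part, leaving a constant that depends on \<open>k\<close> alone.\<close>
  have "f (Some z) - G (Some z) = 0" if "z \<in> closure ?A" for z
  proof (rule holomorphic_Re_boundary_finite_imp_zero[where A = ?A and
        g = "\<lambda>z. f (Some z) - G (Some z)" and
        C = "(\<lambda>k. ln \<tau> - (\<Sum>j = 1..l. m j * c j k)) ` {1..l}"])
    show "open ?A" using op by (rule open_vimage_Some_sphere)
    show "connected ?A" using op con N by (rule connected_vimage_Some_sphere)
    show "\<not> bounded ?A"
      using bounded_Compl_vimage_Some_sphere[OF op N] cobounded_imp_unbounded by blast
    show "(\<lambda>z. f (Some z) - G (Some z)) holomorphic_on ?A"
      using sphere_analytic_finite_part[OF fan] sphere_analytic_finite_part[OF Gan]
      by (intro holomorphic_on_diff analytic_imp_holomorphic)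
    show "continuous_on (closure ?A) (\<lambda>z. f (Some z) - G (Some z))"
      using fcont Gcont by (intro continuous_on_diff continuous_on_closure_finite_part)
    \<comment> \<open>Both functions are normalized to 0 at infinity, so the modulus is the distance
      to the value there.\<close>
    show "bounded {z \<in> closure ?A. e \<le> cmod (f (Some z) - G (Some z))}" if "e > 0" for e
      using continuous_on_closure_bounded_level[OF continuous_on_closure_diff[OF fcont Gcont] N that]
      by (simp add: fN GN)
    show "Re (f (Some z) - G (Some z)) \<in> (\<lambda>k. ln \<tau> - (\<Sum>j = 1..l. m j * c j k)) ` {1..l}"
      if "z \<in> closure ?A - ?A" for z
    proof -
      obtain k t where kt: "(k, t) \<in> param_set l" "z = \<eta> (k, t)" using \<open>z \<in> closure ?A - ?A\<close> bd by auto
      then have "Re (f (Some z) - G (Some z)) = ln \<tau> - (\<Sum>j = 1..l. m j * c j k)"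
        using Ref ReG c by simp
      then show ?thesis using kt(1) by (auto simp: param_set_def)
    qed
  qed (use that in auto)
  then have fG: "f (Some z) = G (Some z)" if "z \<in> closure ?A" for z using that by simp
  have fGb: "f (Some (\<eta> t)) = G (Some (\<eta> t))" if "t \<in> param_set l" for t
    using fG bd that by blast
  have "f z = G z" if "z \<in> K" for z
    using that fN GN fG by (cases z) (auto intro: closure_subset[THEN subsetD])
  moreover have "\<mu> t = (\<Sum>j = 1..l. m j * \<mu>s j t)" if "t \<in> param_set l" for t
    using fGb[OF that] ImG[OF that] by (simp add: \<mu>)
  \<comment> \<open>Equality of \<open>f\<close> and \<open>G\<close> on the boundary forces each of
    the constants in \<open>C\<close> to be 0, which is this identity.\<close>
  moreover have "ln \<tau> = (\<Sum>j = 1..l. m j * h j t)" if "t \<in> param_set l" for t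
    using fGb[OF that] ReG[OF that] Ref[OF that] by simp
  moreover have "f (Some (\<eta> t)) = of_real (ln \<tau> + \<gamma> t) + \<i> * of_real (\<mu> t)"
    if "t \<in> param_set l" for t
    using Ref[OF that] by (simp add: complex_eq_iff \<mu>)
  ultimately show ?thesis using fan fN by (simp add: G_def)
qed

end
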